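(* Let $n,m\in\mathbb{N}$, let $f\in\mathcal{F}^n$ be lower semicontinuous and let $g\in\mathcal{F}^{n,m}_f$ (with linked closed set $C$) be such that $g(x,\cdot)$ is lower semicontinuous for all $x\in\mathbb{R}^n$. Then the following statements are equivalent: (1) $R(\gamma_{g,f})=\{0\}$; (2) $m(\gamma_{g,f})$ is nonempty and compact.
   Context: $\overline{\mathbb{R}}=\mathbb{R}\cup\{-\infty,+\infty\}$. A non-negative function $g:\mathbb{R}^n\times\mathbb{R}^m\to\overline{\mathbb{R}}$ is a G-coupling function if there is a non-empty closed set $C\subset\mathbb{R}^m$ (the closed set linked to $g$) such that (D1) $g$ is real-valued on $\mathbb{R}^n\times C$ and $g(x,x^* )=+\infty$ for every $x\in\mathbb{R}^n$, $x^*\notin C$; (D2) $\inf_{x\in\mathbb{R}^n,\,x^*\in C}g(x,x^* )=0$. $\mathcal{F}^{n,m}$ is the set of all such functions. A function with values in $\mathbb{R}\cup\{+\infty\}$ is proper if it is not identically $+\infty$. $\mathcal{F}^n$ is the set of proper functions $f:\mathbb{R}^n\to\mathbb{R}\cup\{+\infty\}$ with $\inf f>-\infty$. For $f\in\mathcal{F}^n$ and $g\in\mathcal{F}^{n,m}$ with linked set $C$, define $f^g:C\to\mathbb{R}\cup\{+\infty\}$ by $f^g(x^* )=\sup_{x\in\mathbb{R}^n}\{g(x,x^* )-f(x)\}$, and $\gamma_{g,f}:\mathbb{R}^n\times\mathbb{R}^m\to\mathbb{R}\cup\{+\infty\}$ by $\gamma_{g,f}(x,x^* )=f(x)+f^g(x^*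 )$ if $x^*\in C$ and $+\infty$ otherwise. $\mathcal{F}^{n,m}_f=\{g\in\mathcal{F}^{n,m}: f^g\text{ is proper and }\inf\gamma_{g,f}=0\}$. For $A\subset\mathbb{R}^p$ non-empty, $A^\infty=\{d\in\mathbb{R}^p:\ \exists \{x_k\}_{k\in\mathbb{N}}\subset A,\ \{t_k\}_{k\in\mathbb{N}}\downarrow 0 \text{ (with } t_k>0)\text{ such that } t_kx_k\to d\}$, and $\emptyset^\infty=\{0\}$. $S_\lambda(\gamma_{g,f})=\{(x,x^* ):\gamma_{g,f}(x,x^* )\le\lambda\}$. $m(\gamma_{g,f})=\{(x,x^* )\in\mathbb{R}^n\times C:\gamma_{g,f}(x,x^* )=0\}$. $R(\gamma_{g,f})=\bigcap_{(x,x^* )\in\mathbb{R}^n\times C}\left(S_{\gamma_{g,f}(x,x^* )}(\gamma_{g,f})\right)^\infty$. *)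

theory Defs
  imports "HOL-Analysis.Analysis"
begin

definition lsc :: "('a::topological_space \<Rightarrow> ereal) \<Rightarrow> bool" where
  "lsc f \<longleftrightarrow> (\<forall>x. f x \<le> Liminf (at x) f)"

text \<open>
  Functions into \<open>\<real> \<union> {+\<infinity>}\<close> are modelled as \<open>ereal\<close>-valued functions that
  avoid \<open>-\<infinity>\<close>; a function defined only on a subset \<open>D\<close> is a total function whose values
  outside \<open>D\<close> are irrelevant.
\<close>

definition proper_on :: "'a set \<Rightarrow> ('a \<Rightarrow> ereal) \<Rightarrow> bool" where
  "proper_on D h \<longleftrightarrow> (\<forall>x\<in>D. h x \<noteq> -\<infinity>) \<and> (\<exists>x\<in>D. h x \<noteq> \<infinity>)"

definition proper_bdd_below :: "((real ^ 'n) \<Rightarrow> ereal) set" where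
  "proper_bdd_below = {f. proper_on UNIV f \<and> (INF x. f x) > -\<infinity>}"

definition linked_set :: "((real ^ 'n) \<times> (real ^ 'm) \<Rightarrow> ereal) \<Rightarrow> (real ^ 'm) set \<Rightarrow> bool" where
  "linked_set g C \<longleftrightarrow>
     C \<noteq> {} \<and> closed C \<and>
     (\<forall>x. \<forall>y\<in>C. \<bar>g (x, y)\<bar> \<noteq> \<infinity>) \<and>
     (\<forall>x. \<forall>y. y \<notin> C \<longrightarrow> g (x, y) = \<infinity>) \<and>
     (INF p\<in>UNIV \<times> C. g p) = 0"

lemma linked_set_unique:
  assumes "linked_set g C" "linked_set g D"
  shows "C = D"
proof (rule set_eqI)
  have *: "y \<in> C \<longleftrightarrow> \<bar>g (0, y)\<bar> \<noteq> \<infinity>" if "linked_set g C" for C y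
  proof (cases "y \<in> C")
    case True
    then show ?thesis using that by (simp add: linked_set_def)
  next
    case False
    then have "g (0, y) = \<infinity>" using that by (simp add: linked_set_def)
    then show ?thesis using False by simp
  qed
  fix y
  show "y \<in> C \<longleftrightarrow> y \<in> D"
    by (simp only: *[OF assms(1)] *[OF assms(2)])
qed

definition G_couplings :: "((real ^ 'n) \<times> (real ^ 'm) \<Rightarrow> ereal) set" where
  "G_couplings = {g. (\<forall>p. 0 \<le> g p) \<and> (\<exists>C. linked_set g C)}"

text \<open>
  Only the values of \<open>g_conj f g\<close> on the set linked to \<open>g\<close> are used. There
  \<open>g (x, y)\<close> is finite, so for \<open>f\<close> avoiding \<open>-\<infinity>\<close> the difference is never of the
  indeterminate form \<open>\<infinity> - \<infinity>\<close>.
\<close>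

definition g_conj ::
  "((real ^ 'n) \<Rightarrow> ereal) \<Rightarrow> ((real ^ 'n) \<times> (real ^ 'm) \<Rightarrow> ereal) \<Rightarrow> (real ^ 'm) \<Rightarrow> ereal" where
  "g_conj f g y = (SUP x. g (x, y) - f x)"

definition gap ::
  "(real ^ 'm) set \<Rightarrow> ((real ^ 'n) \<times> (real ^ 'm) \<Rightarrow> ereal) \<Rightarrow> ((real ^ 'n) \<Rightarrow> ereal) \<Rightarrow>
   (real ^ 'n) \<times> (real ^ 'm) \<Rightarrow> ereal" where
  "gap C g f = (\<lambda>(x, y). if y \<in> C then f x + g_conj f g y else \<infinity>)"

definition G_couplings_for ::
  "((real ^ 'n) \<Rightarrow> ereal) \<Rightarrow> ((real ^ 'n) \<times> (real ^ 'm) \<Rightarrow> ereal) set" where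
  "G_couplings_for f =
     {g \<in> G_couplings. \<exists>C. linked_set g C \<and> proper_on C (g_conj f g) \<and> (INF p. gap C g f p) = 0}"

definition asymptotic_cone :: "'a::euclidean_space set \<Rightarrow> 'a set" where
  "asymptotic_cone A =
     (if A = {} then {0}
      else {d. \<exists>x t. (\<forall>k::nat. x k \<in> A) \<and> (\<forall>k. 0 < (t k :: real)) \<and> decseq t \<and>
                 t \<longlonglongrightarrow> 0 \<and> (\<lambda>k. t k *\<^sub>R x k) \<longlonglongrightarrow> d})"

definition sublevel :: "('a \<Rightarrow> ereal) \<Rightarrow> ereal \<Rightarrow> 'a set" where
  "sublevel h l = {p. h p \<le> l}"

definition gap_zeros ::
  "(real ^ 'm) set \<Rightarrow> ((real ^ 'n) \<times> (real ^ 'm) \<Rightarrow> ereal) \<Rightarrow> ((real ^ 'n) \<Rightarrow> ereal) \<Rightarrow>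
   ((real ^ 'n) \<times> (real ^ 'm)) set" where
  "gap_zeros C g f = {p \<in> UNIV \<times> C. gap C g f p = 0}"

text \<open>
  The level \<open>gap C g f p\<close> may be \<open>+\<infinity>\<close>; the corresponding sublevel set is then the
  whole space.
\<close>

definition gap_recession ::
  "(real ^ 'm) set \<Rightarrow> ((real ^ 'n) \<times> (real ^ 'm) \<Rightarrow> ereal) \<Rightarrow> ((real ^ 'n) \<Rightarrow> ereal) \<Rightarrow>
   ((real ^ 'n) \<times> (real ^ 'm)) set" where
  "gap_recession C g f =
     (\<Inter>p\<in>UNIV \<times> C. asymptotic_cone (sublevel (gap C g f) (gap C g f p)))"

end

theory Submission imports Defs begin

text \<open>
  The sublevel sets of the gap function at finite levels are closed. If all of them were unbounded,
  normalising points of norm tending to infinity along a minimising sequence of levels would give a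
  unit vector lying in every asymptotic cone. So if the recession set is trivial, some nonempty
  sublevel set is compact, and the infimum \<open>0\<close> is attained, on a compact set. Conversely,
  when the zero set is nonempty and compact it is itself one of the sublevel sets, and its
  asymptotic cone is trivial.
\<close>

section \<open>Asymptotic cones\<close>

lemma zero_in_asymptotic_cone: "0 \<in> asymptotic_cone A"
proof (cases "A = {}")
  case False
  then obtain a where a: "a \<in> A" by blast
  have t: "(\<lambda>k. inverse (real (Suc k))) \<longlonglongrightarrow> 0"
    by (rule LIMSEQ_inverse_real_of_nat)
  have "(\<lambda>k. inverse (real (Suc k)) *\<^sub>R a) \<longlonglongrightarrow> 0 *\<^sub>R a"
    by (intro tendsto_scaleR t tendsto_const)
  moreover have "decseq (\<lambda>k. inverse (real (Suc k)))"
    by (auto simp: decseq_def intro!: le_imp_inverse_le)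
  ultimately show ?thesis
    using a t False unfolding asymptotic_cone_def
    by (auto intro!: exI[of _ "\<lambda>k::nat. a"] exI[of _ "\<lambda>k. inverse (real (Suc k))"] simp del: of_nat_Suc)
qed (simp add: asymptotic_cone_def)

text \<open>A null sequence of scalars times a bounded sequence tends to 0, so no other limit can
  occur.\<close>

lemma asymptotic_cone_bounded:
  assumes "bounded A"
  shows "asymptotic_cone A = {0}"
proof -
  have "d = 0" if d_in: "d \<in> asymptotic_cone A" for d
  proof (cases "A = {}")
    case False
    then obtain x t where x: "\<And>k::nat. x k \<in> A" and t: "t \<longlonglongrightarrow> (0::real)"
      and d: "(\<lambda>k. t k *\<^sub>R x k) \<longlonglongrightarrow> d"
      using d_in False unfolding asymptotic_cone_def by auto
    obtain B where "\<forall>a\<in>A. norm a \<le> B"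
      using assms by (auto simp: bounded_iff)
    then have "Bseq x"
      using x by (intro BseqI') blast
    moreover have "Zfun t sequentially"
      using t by (simp add: tendsto_Zfun_iff)
    ultimately have "Zfun (\<lambda>k. t k *\<^sub>R x k) sequentially"
      by (intro bounded_bilinear.Zfun_prod_Bfun[OF bounded_bilinear_scaleR])
    then have "(\<lambda>k. t k *\<^sub>R x k) \<longlonglongrightarrow> 0"
      by (simp add: tendsto_Zfun_iff)
    then show ?thesis
      using d LIMSEQ_unique by blast
  qed (use d_in in \<open>simp add: asymptotic_cone_def\<close>)
  then show ?thesis using zero_in_asymptotic_cone by blast
qed

text \<open>Dropping an initial segment puts all points into \<open>A\<close>, and a monotone
  subsequence of the scalars supplies the monotonicity that \<open>asymptotic_cone\<close>
  demands.\<close>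

lemma asymptotic_coneI_eventually:
  assumes "\<forall>\<^sub>F k in sequentially. x k \<in> A" and "\<And>k. 0 < t k"
    and "t \<longlonglongrightarrow> 0" and "(\<lambda>k. t k *\<^sub>R x k) \<longlonglongrightarrow> d"
  shows "d \<in> asymptotic_cone A"
proof -
  obtain N where N: "\<And>k. k \<ge> N \<Longrightarrow> x k \<in> A"
    using assms(1) by (auto simp: eventually_sequentially)
  obtain r :: "nat \<Rightarrow> nat" where r: "strict_mono r" "monoseq (\<lambda>k. t (r k + N))"
    using seq_monosub[of "\<lambda>k. t (k + N)"] by auto
  have sm: "strict_mono (\<lambda>k. r k + N)"
    using r(1) by (simp add: strict_mono_def)
  have lim: "(\<lambda>k. t (r k + N)) \<longlonglongrightarrow> 0"
    using LIMSEQ_subseq_LIMSEQ[OF assms(3) sm] by (simp add: o_def)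
  have "decseq (\<lambda>k. t (r k + N))"
  \<comment> \<open>A monotone sequence that is not decreasing is increasing, and an increasing
    sequence with limit 0 has no positive terms.\<close>
  proof (rule ccontr)
    assume "\<not> ?thesis"
    then have "incseq (\<lambda>k. t (r k + N))"
      using r(2) by (simp add: monoseq_iff)
    then have "t (r 0 + N) \<le> 0"
      using lim incseq_le by blast
    then show False using assms(2)[of "r 0 + N"] by simp
  qed
  moreover have "(\<lambda>k. t (r k + N) *\<^sub>R x (r k + N)) \<longlonglongrightarrow> d"
    using LIMSEQ_subseq_LIMSEQ[OF assms(4) sm] by (simp add: o_def)
  moreover have "\<And>k. x (r k + N) \<in> A" using N by simp
  ultimately show ?thesis
    using lim assms(2) unfolding asymptotic_cone_def
    by (auto intro!: exI[of _ "\<lambda>k. x (r k + N)"] exI[of _ "\<lambda>k. t (r k + N)"])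
qed

section \<open>Functions with closed sublevel sets\<close>

text \<open>The form "eventually below every value of \<open>h\<close>" covers both cases: a
  minimiser gives a constant sequence, and otherwise values decreasing to the infimum pass strictly
  below each \<open>h q\<close>.\<close>

lemma minimizing_sequence:
  fixes h :: "'a \<Rightarrow> ereal"
  obtains p :: "nat \<Rightarrow> 'a" where "\<And>q. \<forall>\<^sub>F k in sequentially. h (p k) \<le> h q"
proof (cases "\<exists>z. \<forall>q. h z \<le> h q")
  case True
  then obtain z where "\<And>q. h z \<le> h q" by blast
  then show ?thesis using that[of "\<lambda>_. z"] by simp
next
  case False
  obtain u :: "nat \<Rightarrow> ereal" where u: "decseq u" "range u \<subseteq> range h" "Inf (range h) = (INF i. u i)"
    using Inf_countable_INF[of "range h"] by auto
  then have "\<forall>k. \<exists>z. u k = h z" by blast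
  then obtain p where p: "\<And>k. u k = h (p k)" by metis
  show ?thesis
  proof (rule that[of p])
    fix q
    obtain q' where "h q' < h q" using False by (meson not_le)
    then have "(INF i. u i) < h q"
      using u(3) by (metis INF_lower UNIV_I order_le_less_trans)
    then obtain i where "u i < h q" by (auto simp: INF_less_iff)
    then have "\<And>k. k \<ge> i \<Longrightarrow> h (p k) \<le> h q"
      using u(1) p unfolding decseq_def by (metis less_imp_le order_trans)
    then show "\<forall>\<^sub>F k in sequentially. h (p k) \<le> h q"
      by (auto simp: eventually_sequentially)
  qed
qed

lemma common_asymptotic_direction:
  fixes h :: "'a::euclidean_space \<Rightarrow> ereal"
  assumes "\<And>p. \<not> bounded (sublevel h (h p))"
  obtains d where "norm d = 1" "\<And>p. d \<in> asymptotic_cone (sublevel h (h p))"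
proof -
  obtain p :: "nat \<Rightarrow> 'a" where p: "\<And>q. \<forall>\<^sub>F k in sequentially. h (p k) \<le> h q"
    using minimizing_sequence by blast
  \<comment> \<open>The bound \<open>Suc k\<close> keeps the norms positive, so that normalising is
    possible, and makes their inverses tend to 0.\<close>
  have "\<exists>q. h q \<le> h (p k) \<and> norm q > real (Suc k)" for k
    using assms[of "p k"] unfolding bounded_iff sublevel_def by (auto simp: not_le)
  then obtain q where q: "\<And>k. h (q k) \<le> h (p k)" "\<And>k. norm (q k) > real (Suc k)"
    by metis
  have q0: "norm (q k) > 0" for k using q(2)[of k] by linarith
  have "\<forall>k. (1 / norm (q k)) *\<^sub>R q k \<in> sphere 0 1"
    using less_imp_neq[OF q0] by auto
  then obtain d r where dr: "d \<in> sphere 0 1" "strict_mono (r :: nat \<Rightarrow> nat)"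
      "((\<lambda>k. (1 / norm (q k)) *\<^sub>R q k) \<circ> r) \<longlonglongrightarrow> d"
    by (rule seq_compactE[OF compact_imp_seq_compact[OF compact_sphere[of "0::'a" 1]]])
  have "(\<lambda>k. 1 / norm (q k)) \<longlonglongrightarrow> 0"
  proof (rule tendsto_sandwich[OF _ _ tendsto_const LIMSEQ_inverse_real_of_nat])
    show "\<forall>\<^sub>F k in sequentially. 1 / norm (q k) \<le> inverse (real (Suc k))"
      using q(2) by (intro always_eventually allI) (simp add: inverse_eq_divide frac_le less_imp_le del: of_nat_Suc)
  qed simp
  then have t: "(\<lambda>k. 1 / norm (q (r k))) \<longlonglongrightarrow> 0"
    using LIMSEQ_subseq_LIMSEQ[OF _ dr(2)] by (fastforce simp: o_def)
  have "d \<in> asymptotic_cone (sublevel h (h z))" for z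
  proof (rule asymptotic_coneI_eventually)
    have "\<forall>\<^sub>F k in sequentially. q k \<in> sublevel h (h z)"
      using p[of z] by eventually_elim (use q(1) order_trans in \<open>auto simp: sublevel_def\<close>)
    then show "\<forall>\<^sub>F k in sequentially. q (r k) \<in> sublevel h (h z)"
      using dr(2) by (rule eventually_subseq[rotated])
    show "(\<lambda>k. (1 / norm (q (r k))) *\<^sub>R q (r k)) \<longlonglongrightarrow> d"
      using dr(3) by (simp add: o_def)
  qed (use q0 t in auto)
  with dr(1) show ?thesis using that by auto
qed

lemma compact_argmin_of_bounded_sublevel:
  fixes h :: "'a::euclidean_space \<Rightarrow> ereal"
  assumes closed: "\<And>r::real. closed (sublevel h (ereal r))"
    and inf: "(INF p. h p) = ereal c"
    and bdd: "bounded (sublevel h (h p))"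
  shows "{p. h p = ereal c} \<noteq> {} \<and> compact {p. h p = ereal c}"
proof -
  have ge: "ereal c \<le> h z" for z
    using inf by (metis INF_lower UNIV_I)
  \<comment> \<open>At level \<infinity> the sublevel set would be the whole space, which is
    unbounded.\<close>
  have "h p \<noteq> \<infinity>"
    using bdd by (auto simp: sublevel_def)
  then obtain s where s: "h p = ereal s"
    using ge[of p] by (cases "h p") auto
  have cs: "compact (sublevel h (ereal s))"
    using closed[of s] bdd s by (simp add: compact_eq_bounded_closed)
  obtain u :: "nat \<Rightarrow> 'a" where u: "\<And>q. \<forall>\<^sub>F k in sequentially. h (u k) \<le> h q"
    using minimizing_sequence by blast
  obtain N where N: "\<And>k. k \<ge> N \<Longrightarrow> h (u k) \<le> ereal s"
    using u[of p] s by (auto simp: eventually_sequentially)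
  have "\<forall>k. u (k + N) \<in> sublevel h (ereal s)"
    using N by (simp add: sublevel_def)
  then obtain z r where z: "strict_mono (r :: nat \<Rightarrow> nat)" "((\<lambda>k. u (k + N)) \<circ> r) \<longlonglongrightarrow> z"
    using cs unfolding compact_def by meson
  have sm: "strict_mono (\<lambda>k. r k + N)"
    using z(1) by (simp add: strict_mono_def)
  have "h z \<le> ereal c"
  \<comment> \<open>Each sublevel set at a level \<open>c + e\<close> with \<open>e > 0\<close> is
    closed and eventually contains the subsequence, hence contains its limit
    \<open>z\<close>.\<close>
  proof (rule ereal_le_epsilon2)
    fix e :: real assume e: "e > 0"
    have "(INF p. h p) < ereal (c + e)" unfolding inf using e by simp
    then obtain q where q: "h q < ereal (c + e)" by (auto simp: INF_less_iff)
    have "\<forall>\<^sub>F k in sequentially. h (u (r k + N)) \<le> h q"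
      using eventually_subseq[OF sm u[of q]] .
    then have "\<forall>\<^sub>F k in sequentially. u (r k + N) \<in> sublevel h (ereal (c + e))"
      by eventually_elim (use q in \<open>auto simp: sublevel_def intro: order_trans less_imp_le\<close>)
    moreover have "(\<lambda>k. u (r k + N)) \<longlonglongrightarrow> z"
      using z(2) by (simp add: o_def)
    ultimately have "z \<in> sublevel h (ereal (c + e))"
      using Lim_in_closed_set[OF closed[of "c + e"]] by fastforce
    then show "h z \<le> ereal c + ereal e" by (simp add: sublevel_def)
  qed
  then have "h z = ereal c" using ge[of z] by simp
  moreover have "{p. h p = ereal c} = sublevel h (ereal c) \<inter> sublevel h (ereal s)"
    using ge[of p] ge s by (auto simp: sublevel_def intro: antisym)
  ultimately show ?thesis
    using closed_Int_compact[OF closed[of c] cs] by auto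
qed

text \<open>The assumption on \<open>D\<close> forces every point where the finite value
  \<open>c\<close> is attained into \<open>D\<close>, so the cone of the set of minimisers takes
  part in the intersection.\<close>

lemma asymptotic_cones_trivial_iff:
  fixes h :: "'a::euclidean_space \<Rightarrow> ereal"
  assumes "\<And>r::real. closed (sublevel h (ereal r))"
    and inf: "(INF p. h p) = ereal c"
    and D: "\<And>p. p \<notin> D \<Longrightarrow> h p = \<infinity>"
  shows "(\<Inter>p\<in>D. asymptotic_cone (sublevel h (h p))) = {0} \<longleftrightarrow>
    {p. h p = ereal c} \<noteq> {} \<and> compact {p. h p = ereal c}"
proof
  assume L: "(\<Inter>p\<in>D. asymptotic_cone (sublevel h (h p))) = {0}"
  have "\<exists>p. bounded (sublevel h (h p))"
  proof (rule ccontr)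
    assume "\<not> ?thesis"
    then obtain d where "norm d = 1" "\<And>p. d \<in> asymptotic_cone (sublevel h (h p))"
      using common_asymptotic_direction[of h] by blast
    then have "d \<in> {0}" using L by blast
    with \<open>norm d = 1\<close> show False by simp
  qed
  then show "{p. h p = ereal c} \<noteq> {} \<and> compact {p. h p = ereal c}"
    using compact_argmin_of_bounded_sublevel assms(1) inf by blast
next
  assume R: "{p. h p = ereal c} \<noteq> {} \<and> compact {p. h p = ereal c}"
  then obtain p where p: "h p = ereal c" by blast
  then have "p \<in> D" using D by fastforce
  have ge: "ereal c \<le> h z" for z
    using inf by (metis INF_lower UNIV_I)
  have "sublevel h (h p) = {p. h p = ereal c}"
    using p ge by (auto simp: sublevel_def intro: antisym)
  then have "asymptotic_cone (sublevel h (h p)) = {0}"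
    using R asymptotic_cone_bounded compact_imp_bounded by metis
  with \<open>p \<in> D\<close> show "(\<Inter>p\<in>D. asymptotic_cone (sublevel h (h p))) = {0}"
    using zero_in_asymptotic_cone by blast
qed

section \<open>Lower semicontinuity of the gap function\<close>

lemma lsc_open_superlevel:
  assumes "lsc u"
  shows "open {x. a < u x}"
proof (subst open_subopen, safe)
  fix x assume "a < u x"
  then have "a < Liminf (at x) u"
    using assms unfolding lsc_def by (meson less_le_trans)
  then obtain b where "a < b" "\<forall>\<^sub>F y in at x. b < u y"
    using less_LiminfD dense by (metis less_LiminfD)
  \<comment> \<open>\<open>lsc\<close> speaks of punctured neighbourhoods only; the centre is
    restored by \<open>a < u x\<close>.\<close>
  then have "\<forall>\<^sub>F y in nhds x. a < u y"
    using \<open>a < u x\<close> unfolding eventually_at_filter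
    by (auto elim!: eventually_mono intro: less_trans)
  then show "\<exists>T. open T \<and> x \<in> T \<and> T \<subseteq> {x. a < u x}"
    unfolding eventually_nhds by blast
qed

text \<open>Splitting the bound at a real \<open>r\<close> turns a strict superlevel set of a sum in
  separate variables into a union of rectangles, which are open for lower semicontinuous
  summands.\<close>

lemma less_ereal_add_iff:
  fixes a b :: ereal
  assumes "a \<noteq> -\<infinity>" "b \<noteq> -\<infinity>"
  shows "ereal c < a + b \<longleftrightarrow> (\<exists>r. ereal r < a \<and> ereal (c - r) < b)"
proof
  assume L: "ereal c < a + b"
  show "\<exists>r. ereal r < a \<and> ereal (c - r) < b"
  proof (cases b)
    case (real v)
    then have "ereal (c - v) < a" using L by (cases a) auto
    then obtain r where "ereal (c - v) < ereal r" "ereal r < a"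
      using ereal_dense2 by blast
    then show ?thesis using real by (intro exI[of _ r]) auto
  next
    case PInf
    obtain r where "ereal r < a"
      using assms(1) ereal_dense2[of "-\<infinity>" a] by auto
    then show ?thesis using PInf by auto
  qed (use assms in simp)
next
  assume "\<exists>r. ereal r < a \<and> ereal (c - r) < b"
  then show "ereal c < a + b" by (cases a; cases b) auto
qed

lemma closed_lsc_add_le:
  assumes "lsc u" "lsc v" "\<And>x. u x \<noteq> -\<infinity>" "\<And>y. v y \<noteq> -\<infinity>"
  shows "closed {(x, y). u x + v y \<le> ereal c}"
proof -
  have "- {(x, y). u x + v y \<le> ereal c} = (\<Union>r. {x. ereal r < u x} \<times> {y. ereal (c - r) < v y})"
    by (simp add: set_eq_iff not_le less_ereal_add_iff[OF assms(3,4)])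
  then have "open (- {(x, y). u x + v y \<le> ereal c})"
    using lsc_open_superlevel[OF assms(1)] lsc_open_superlevel[OF assms(2)]
    by (auto intro!: open_Times)
  then show ?thesis by (simp add: closed_def)
qed

text \<open>
  Clearing the subtraction in the conjugate leaves, for each point of the effective domain of
  \<open>f\<close>, an inequality between sums without indeterminate forms; since \<open>g\<close> is
  \<open>+\<infinity>\<close> off \<open>C\<close>, the restriction to \<open>C\<close> is then automatic.
\<close>

lemma sublevel_gap_eq:
  assumes "proper_on UNIV f" and "linked_set g C"
  shows "sublevel (gap C g f) (ereal l) =
    (\<Inter>x'\<in>{x'. f x' \<noteq> \<infinity>}. {(x, y). f x + g (x', y) \<le> ereal (l + real_of_ereal (f x'))})"
    (is "_ = ?R")
proof -
  have f: "f x \<noteq> -\<infinity>" for x using assms(1) by (simp add: proper_on_def)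
  obtain x0 where x0: "f x0 \<noteq> \<infinity>" using assms(1) by (auto simp: proper_on_def)
  have *: "(x, y) \<in> sublevel (gap C g f) (ereal l) \<longleftrightarrow> (x, y) \<in> ?R" for x y
  proof (cases "y \<in> C")
    case False
    then have "g (x0, y) = \<infinity>" using assms(2) by (simp add: linked_set_def)
    then show ?thesis
      using False x0 f by (auto simp: sublevel_def gap_def intro!: exI[of _ x0])
  next
    case True
    then have g: "\<bar>g (x', y)\<bar> \<noteq> \<infinity>" for x' using assms(2) by (simp add: linked_set_def)
    have "g (x0, y) - f x0 \<noteq> -\<infinity>"
      using g[of x0] f[of x0] x0 by (cases "g (x0, y)"; cases "f x0") auto
    then have conj: "g_conj f g y \<noteq> -\<infinity>"
      unfolding g_conj_def by (metis SUP_upper UNIV_I ereal_infty_less_eq(2))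
    show ?thesis
    proof (cases "f x")
      case (real s)
      have "(x, y) \<in> sublevel (gap C g f) (ereal l) \<longleftrightarrow> g_conj f g y \<le> ereal (l - s)"
        using True real by (cases "g_conj f g y") (auto simp: sublevel_def gap_def)
      also have "\<dots> \<longleftrightarrow> (\<forall>x'. g (x', y) - f x' \<le> ereal (l - s))"
        by (simp add: g_conj_def SUP_le_iff)
      \<comment> \<open>Where \<open>f x'\<close> is \<infinity>, the difference is -\<infinity> and
        imposes no constraint; elsewhere all terms are finite and can be rearranged.\<close>
      also have "\<dots> \<longleftrightarrow> (\<forall>x'. f x' \<noteq> \<infinity> \<longrightarrow> f x + g (x', y) \<le> ereal (l + real_of_ereal (f x')))"
      proof (rule all_cong1)
        fix x'
        show "g (x', y) - f x' \<le> ereal (l - s) \<longleftrightarrow>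
            (f x' \<noteq> \<infinity> \<longrightarrow> f x + g (x', y) \<le> ereal (l + real_of_ereal (f x')))"
          using g[of x'] f[of x'] real by (cases "g (x', y)"; cases "f x'") auto
      qed
      finally show ?thesis by simp
    next
      case PInf
      then show ?thesis
        using True conj x0 g f by (auto simp: sublevel_def gap_def)
    qed (use f in simp)
  qed
  show ?thesis by (rule set_eqI) (simp only: split_paired_all *)
qed

text \<open>With \<open>x'\<close> fixed, \<open>f x + g (x', y)\<close> separates \<open>x\<close>
  from \<open>y\<close>, so lower semicontinuity of \<open>g\<close> in its second argument is
  enough; closedness survives the intersection over \<open>x'\<close>.\<close>

lemma closed_sublevel_gap:
  assumes "proper_on UNIV f" "lsc f" "linked_set g C" "\<And>p. 0 \<le> g p" "\<And>x. lsc (\<lambda>y. g (x, y))"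
  shows "closed (sublevel (gap C g f) (ereal l))"
  unfolding sublevel_gap_eq[OF assms(1,3)]
proof (intro closed_INT ballI closed_lsc_add_le assms(2,5))
  show "f x \<noteq> -\<infinity>" for x using assms(1) by (simp add: proper_on_def)
  show "g (x', y) \<noteq> -\<infinity>" for x' y using assms(4)[of "(x', y)"] by auto
qed

theorem theorem3p13:
  fixes f :: "(real ^ 'n) \<Rightarrow> ereal"
    and g :: "(real ^ 'n) \<times> (real ^ 'm) \<Rightarrow> ereal"
    and C :: "(real ^ 'm) set"
  assumes "f \<in> proper_bdd_below"
    and "lsc f"
    and "g \<in> G_couplings_for f"
    and "linked_set g C"
    and "\<And>x. lsc (\<lambda>y. g (x, y))"
  shows "gap_recession C g f = {0} \<longleftrightarrow> gap_zeros C g f \<noteq> {} \<and> compact (gap_zeros C g f)"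
proof -
  have f: "proper_on UNIV f" using assms(1) by (simp add: proper_bdd_below_def)
  have g: "\<And>p. 0 \<le> g p"
    using assms(3) by (auto simp: G_couplings_for_def G_couplings_def)
  have inf: "(INF p. gap C g f p) = ereal 0"
    \<comment> \<open>The linked set in \<open>G_couplings_for\<close> is existentially bound;
      uniqueness identifies it with \<open>C\<close>.\<close>
    using assms(3,4) linked_set_unique by (force simp: G_couplings_for_def zero_ereal_def)
  have off: "gap C g f p = \<infinity>" if "p \<notin> UNIV \<times> C" for p
    using that by (cases p) (auto simp: gap_def)
  have "p \<in> UNIV \<times> C" if "gap C g f p = 0" for p
    using that off[of p] by (metis PInfty_neq_ereal(1) zero_ereal_def)
  then have "gap_zeros C g f = {p. gap C g f p = ereal 0}"
    unfolding gap_zeros_def zero_ereal_def[symmetric] by blast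
  then show ?thesis
    using asymptotic_cones_trivial_iff[OF closed_sublevel_gap[OF f assms(2,4) g assms(5)] inf off]
    by (simp add: gap_recession_def)
qed

end
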